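(* Let $p$ be an odd prime and let $C_k=\binom{2k}{k}/(k+1)$ denote the $k$-th Catalan number. (i) If $p\equiv 3\pmod 4$, then $$\sum_{k=0}^{(p-1)/2}\frac{\binom{2k}kC_k}{8^k}\equiv-2\sum_{k=0}^{(p-1)/2}\frac{k\binom{2k}k^2}{8^k}\equiv-\frac12\sum_{k=0}^{(p-1)/2}\frac{\binom{2k}kC_k}{(-16)^k}\equiv4\sum_{k=0}^{(p-1)/2}\frac{k\binom{2k}k^2}{(-16)^k}\equiv\frac{(-1)^{(p+1)/4}}2\binom{(p+1)/2}{(p+1)/4}\pmod{p}$$ and $$\sum_{k=0}^{(p-1)/2}\frac{\binom{2k}k^2}{8^k}\equiv-\sum_{k=0}^{(p-1)/2}\frac{\binom{2k}k^2}{(-16)^k}\equiv\frac{2p(-1)^{(p+1)/4}}{\binom{(p+1)/2}{(p+1)/4}}\pmod{p^2}.$$ (ii) For every $d\in\{0,1,\ldots,(p-1)/2\}$ with $d\equiv (p+1)/2\pmod 2$, $$\sum_{k=0}^{(p-1)/2}\frac{\binom{2k}k\binom{2k}{k+d}}{8^k}\equiv0\pmod p.$$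
   Context: For rational numbers $a,b$ whose denominators are not divisible by $p$, $a\equiv b\pmod{p^m}$ means $(a-b)/p^m$ has denominator not divisible by $p$. *)

theory Defs
  imports Complex_Main "HOL-Number_Theory.Cong" "HOL-Computational_Algebra.Primes"
begin

definition catalan :: "nat \<Rightarrow> rat" where
  "catalan k = of_nat ((2 * k) choose k) / of_nat (k + 1)"

definition p_integral :: "nat \<Rightarrow> rat \<Rightarrow> bool" where
  "p_integral p x \<longleftrightarrow> \<not> int p dvd snd (quotient_of x)"

text \<open>The congruence is only meaningful between rationals whose denominators are prime to
  the modulus, so this is part of the relation.\<close>

definition rat_cong :: "nat \<Rightarrow> nat \<Rightarrow> rat \<Rightarrow> rat \<Rightarrow> bool" where
  "rat_cong p m a b \<longleftrightarrow>
     p_integral p a \<and> p_integral p b \<and> p_integral p ((a - b) / of_nat p ^ m)"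

end

theory Submission
  imports Defs "HOL-Computational_Algebra.Polynomial"
begin

text \<open>
  Put \<open>n = (p - 1) / 2\<close>. The coefficients \<open>f\<^sub>k = (-1)^k (n choose k) (n + k choose k)\<close> of the
  shifted Legendre polynomial \<open>F(x) = P\<^sub>n(1 - 2x)\<close> satisfy \<open>(2k choose k)\<^sup>2 / 16^k \<equiv> f\<^sub>k\<close> modulo
  \<open>p\<^sup>2\<close>, so the sums in (i) are values of \<open>F\<close>, of \<open>F'\<close> and of an antiderivative of \<open>F\<close> at \<open>2\<close> and
  \<open>-1\<close>. The Legendre equation expresses the antiderivative through \<open>F'\<close>, and
  \<open>F(1 - x) = (-1)^n F(x)\<close> exchanges \<open>2\<close> and \<open>-1\<close>.

  Let \<open>G(x) = \<Sum> (n choose k)\<^sup>2 x^k\<close>. Then \<open>F \<equiv> G\<close> modulo \<open>p\<close>; for odd \<open>n\<close> one has \<open>G(-1) = 0\<close>,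
  and \<open>G'(-1)\<close> is an explicit binomial coefficient, which gives the congruences modulo \<open>p\<close>.
  For the value \<open>F(-1)\<close> modulo \<open>p\<^sup>2\<close>, the differential equations of \<open>F\<close> and \<open>G\<close> show that
  \<open>V = 2x(1 - x)(G'F - GF') + p x F\<^sup>2\<close> has a derivative divisible by \<open>p\<^sup>2\<close>; since \<open>V(0) = 0\<close> and
  \<open>V\<close> has degree at most \<open>p\<close>, this forces \<open>V \<equiv> p x^p\<close> modulo \<open>p\<^sup>2\<close>, and \<open>x = -1\<close> yields
  \<open>4 G'(-1) F(-1) \<equiv> p\<close>.

  For (ii), \<open>(2k choose k) \<equiv> (-4)^k (n choose k)\<close> modulo \<open>p\<close> turns \<open>2^n\<close> times the sum into the
  coefficient of \<open>x^(n + d)\<close> in \<open>(2x - (1 + x)\<^sup>2)^n = (-1 - x\<^sup>2)^n\<close>.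
\<close>

section \<open>Congruences between \<open>p\<close>-integral rationals\<close>

text \<open>The reduced denominator is coprime to the numerator, so it divides the denominator of
  every other fraction for \<open>x\<close>. Hence any representation may be used to test
  integrality, which makes the closure properties below immediate.\<close>

lemma p_integral_iff:
  "p_integral p x \<longleftrightarrow> (\<exists>a b. \<not> int p dvd b \<and> x = of_int a / of_int b)"
proof
  assume "p_integral p x"
  then show "\<exists>a b. \<not> int p dvd b \<and> x = of_int a / of_int b"
    unfolding p_integral_def by (metis prod.collapse quotient_of_div)
next
  assume "\<exists>a b. \<not> int p dvd b \<and> x = of_int a / of_int b"
  then obtain a b where ab: "\<not> int p dvd b" "x = of_int a / of_int b" by blast
  obtain c d where cd: "quotient_of x = (c, d)" by (cases "quotient_of x")
  have "d > 0" "coprime c d"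
    using cd quotient_of_denom_pos quotient_of_coprime by blast+
  have "b \<noteq> 0" using ab(1) by auto
  have "x = of_int c / of_int d" using cd by (rule quotient_of_div)
  then have "(of_int (c * b) :: rat) = of_int (a * d)"
    using ab(2) \<open>d > 0\<close> \<open>b \<noteq> 0\<close> by (simp add: field_simps)
  then have "c * b = a * d" by (simp only: of_int_eq_iff)
  then have "d dvd b"
    using \<open>coprime c d\<close> by (metis coprime_commute coprime_dvd_mult_right_iff dvd_triv_right)
  then show "p_integral p x"
    unfolding p_integral_def using ab(1) cd by (auto dest: dvd_trans)
qed

lemma p_integral_of_int [simp]: "prime p \<Longrightarrow> p_integral p (of_int a)"
  unfolding p_integral_iff by (rule exI[of _ a], rule exI[of _ 1]) (auto simp: prime_gt_1_nat)

lemma p_integral_of_nat [simp]: "prime p \<Longrightarrow> p_integral p (of_nat a)"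
  using p_integral_of_int[of p "int a"] by simp

lemma p_integral_0 [simp]: "prime p \<Longrightarrow> p_integral p 0"
  and p_integral_1 [simp]: "prime p \<Longrightarrow> p_integral p 1"
  using p_integral_of_int[of p 0] p_integral_of_int[of p 1] by simp_all

lemma p_integral_mult:
  assumes "prime p" "p_integral p x" "p_integral p y"
  shows "p_integral p (x * y)"
proof -
  obtain a b c d where ab: "\<not> int p dvd b" "x = of_int a / of_int b"
    and cd: "\<not> int p dvd d" "y = of_int c / of_int d"
    using assms(2,3) unfolding p_integral_iff by blast
  have "\<not> int p dvd b * d"
    using ab cd \<open>prime p\<close> by (simp add: prime_dvd_mult_iff)
  moreover have "x * y = of_int (a * c) / of_int (b * d)" by (simp add: ab cd)
  ultimately show ?thesis unfolding p_integral_iff by blast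
qed

lemma p_integral_add:
  assumes "prime p" "p_integral p x" "p_integral p y"
  shows "p_integral p (x + y)"
proof -
  obtain a b c d where ab: "\<not> int p dvd b" "x = of_int a / of_int b"
    and cd: "\<not> int p dvd d" "y = of_int c / of_int d"
    using assms(2,3) unfolding p_integral_iff by blast
  have "b \<noteq> 0" "d \<noteq> 0" using ab(1) cd(1) by auto
  have "\<not> int p dvd b * d"
    using ab cd \<open>prime p\<close> by (simp add: prime_dvd_mult_iff)
  moreover have "x + y = of_int (a * d + c * b) / of_int (b * d)"
    using \<open>b \<noteq> 0\<close> \<open>d \<noteq> 0\<close> by (simp add: ab cd field_simps)
  ultimately show ?thesis unfolding p_integral_iff by blast
qed

lemma p_integral_minus: "prime p \<Longrightarrow> p_integral p x \<Longrightarrow> p_integral p (- x)"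
  using p_integral_mult[of p "-1" x] p_integral_of_int[of p "-1"] by simp

lemma p_integral_inverse_of_int: "\<not> int p dvd b \<Longrightarrow> p_integral p (1 / of_int b)"
  unfolding p_integral_iff by (metis of_int_1)

lemma p_integral_power: "prime p \<Longrightarrow> p_integral p x \<Longrightarrow> p_integral p (x ^ k)"
  by (induction k) (auto intro: p_integral_mult)

text \<open>Integrality of \<open>a\<close> comes for free from \<open>a = b + p^m * c\<close>, so
  only \<open>b\<close> and the quotient \<open>c\<close> need to be checked.\<close>

lemma rat_congI:
  assumes "prime p" "p_integral p b" "p_integral p c" "a - b = of_nat p ^ m * c"
  shows "rat_cong p m a b"
proof -
  have "a = b + of_nat p ^ m * c" using assms(4) by (simp add: algebra_simps)
  then have "p_integral p a"
    using assms(1-3) by (simp add: p_integral_add p_integral_mult p_integral_power)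
  moreover have "(a - b) / of_nat p ^ m = c"
    using assms(1,4) prime_gt_0_nat[of p] by simp
  ultimately show ?thesis using assms unfolding rat_cong_def by simp
qed

lemma rat_congE:
  assumes "prime p" "rat_cong p m a b"
  obtains c where "p_integral p a" "p_integral p b" "p_integral p c" "a - b = of_nat p ^ m * c"
  using assms prime_gt_0_nat[of p] that[of "(a - b) / of_nat p ^ m"]
  unfolding rat_cong_def by simp

lemma rat_cong_refl: "prime p \<Longrightarrow> p_integral p a \<Longrightarrow> rat_cong p m a a"
  by (rule rat_congI[of _ _ 0]) auto

lemma rat_cong_sym:
  assumes "prime p" "rat_cong p m a b"
  shows "rat_cong p m b a"
  using assms(2)
proof (rule rat_congE[OF assms(1)])
  fix c assume *: "p_integral p a" "p_integral p b" "p_integral p c" "a - b = of_nat p ^ m * c"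
  have "b - a = of_nat p ^ m * (- c)" using *(4) by simp
  then show ?thesis
    using rat_congI[OF assms(1) *(1) p_integral_minus[OF assms(1) *(3)]] by blast
qed

lemma rat_cong_add:
  assumes "prime p" "rat_cong p m a b" "rat_cong p m a' b'"
  shows "rat_cong p m (a + a') (b + b')"
proof -
  obtain c where c: "p_integral p b" "p_integral p c" "a - b = of_nat p ^ m * c"
    using rat_congE[OF assms(1,2)] by metis
  obtain c' where c': "p_integral p b'" "p_integral p c'" "a' - b' = of_nat p ^ m * c'"
    using rat_congE[OF assms(1,3)] by metis
  show ?thesis
    by (rule rat_congI[of _ _ "c + c'"]) (use c c' assms(1) in
      \<open>auto simp: p_integral_add algebra_simps\<close>)
qed

lemma rat_cong_mult_left:
  assumes "prime p" "p_integral p x" "rat_cong p m a b"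
  shows "rat_cong p m (x * a) (x * b)"
proof -
  obtain c where c: "p_integral p b" "p_integral p c" "a - b = of_nat p ^ m * c"
    using rat_congE[OF assms(1,3)] by metis
  have "x * a - x * b = x * (a - b)" by (simp add: algebra_simps)
  then have "x * a - x * b = of_nat p ^ m * (x * c)" by (simp add: c(3))
  then show ?thesis
    using rat_congI[of p "x * b" "x * c"] assms c p_integral_mult by blast
qed

lemma rat_cong_trans:
  assumes "prime p" "rat_cong p m a b" "rat_cong p m b c"
  shows "rat_cong p m a c"
proof -
  \<comment> \<open>In the sum of the two congruences the middle term \<open>b\<close> cancels from
    the difference.\<close>
  have "rat_cong p m (a + b) (b + c)" using assms by (rule rat_cong_add)
  moreover have "a + b - (b + c) = a - c" by simp
  ultimately show ?thesis using assms unfolding rat_cong_def by metis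
qed

lemma rat_cong_minus: "prime p \<Longrightarrow> rat_cong p m a b \<Longrightarrow> rat_cong p m (- a) (- b)"
  using rat_cong_mult_left[of p "-1" m a b] p_integral_of_int[of p "-1"] by simp

lemma rat_cong_sum:
  "prime p \<Longrightarrow> (\<And>k. k \<in> A \<Longrightarrow> rat_cong p m (f k) (g k)) \<Longrightarrow> rat_cong p m (sum f A) (sum g A)"
  by (induction A rule: infinite_finite_induct) (auto intro: rat_cong_add rat_cong_refl)

lemma rat_cong_of_int:
  assumes "prime p" "[a = b] (mod int p ^ m)"
  shows "rat_cong p m (of_int a) (of_int b)"
proof -
  obtain c where "a - b = int p ^ m * c"
    using assms(2) by (auto simp: cong_iff_dvd_diff)
  then have "(of_int (a - b) :: rat) = of_int (int p ^ m * c)" by simp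
  then show ?thesis
    using rat_congI[of p "of_int b" "of_int c" "of_int a" m] assms(1) by simp
qed

text \<open>The bridge from integer congruences to fractions: \<open>1 / b\<close> is
  \<open>p\<close>-integral, so both sides may be multiplied by it.\<close>

lemma rat_cong_divide:
  assumes "prime p" "\<not> int p dvd b" "[a = b * c] (mod int p ^ m)"
  shows "rat_cong p m (of_int a / of_int b) (of_int c)"
proof -
  have "b \<noteq> 0" using assms(2) by auto
  have "rat_cong p m (1 / of_int b * of_int a) (1 / of_int b * of_int (b * c))"
    by (intro rat_cong_mult_left rat_cong_of_int p_integral_inverse_of_int assms)
  then show ?thesis using \<open>b \<noteq> 0\<close> by simp
qed

lemma rat_cong_weaken:
  assumes "prime p" "rat_cong p 2 a b"
  shows "rat_cong p 1 a b"
proof -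
  obtain c where c: "p_integral p b" "p_integral p c" "a - b = of_nat p ^ 2 * c"
    using rat_congE[OF assms] by metis
  show ?thesis
    by (rule rat_congI[of _ _ "of_nat p * c"])
      (use c assms(1) in \<open>auto simp: p_integral_mult power2_eq_square\<close>)
qed

section \<open>Central binomial and Legendre coefficients\<close>

definition legendre_coeff :: "nat \<Rightarrow> nat \<Rightarrow> int" where
  "legendre_coeff n k = (- 1) ^ k * int (n choose k) * int ((n + k) choose k)"

text \<open>Over the integers the factor \<open>n - k\<close> is harmless for \<open>k > n\<close>,
  where both sides vanish, so the recurrence holds for every \<open>k\<close>.\<close>

lemma binomial_Suc_rec: "int (Suc k) * int (n choose Suc k) = (int n - int k) * int (n choose k)"
proof (cases "k \<le> n")
  case True
  have "Suc k * (n choose Suc k) = (n - k) * (n choose k)"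
    using binomial_absorb_comp[of n k] binomial_absorption[of k "n"]
    by (metis Suc_times_binomial_eq binomial_absorption mult.commute)
  then have "int (Suc k * (n choose Suc k)) = int ((n - k) * (n choose k))" by simp
  then show ?thesis using True by (simp only: of_nat_mult of_nat_diff)
qed (simp add: binomial_eq_0)

text \<open>The two binomial factors contribute \<open>n - k\<close> and \<open>n + k + 1\<close>,
  and \<open>-(n - k)(n + k + 1) = k(k + 1) - n(n + 1)\<close>. In this form it is the Legendre
  equation read off coefficient by coefficient.\<close>

lemma legendre_coeff_rec:
  "(int k + 1)\<^sup>2 * legendre_coeff n (Suc k)
     = (int k * (int k + 1) - int n * (int n + 1)) * legendre_coeff n k"
proof -
  have 1: "(int k + 1) * int (n choose Suc k) = (int n - int k) * int (n choose k)"
    using binomial_Suc_rec[of k n] by (simp add: add.commute)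
  have "Suc k * (Suc (n + k) choose Suc k) = Suc (n + k) * ((n + k) choose k)"
    by (rule Suc_times_binomial_eq[symmetric, THEN trans[OF mult.commute]])
  then have "int (Suc k * (Suc (n + k) choose Suc k)) = int (Suc (n + k) * ((n + k) choose k))"
    by (simp only:)
  then have 2: "(int k + 1) * int ((n + Suc k) choose Suc k)
      = (int n + int k + 1) * int ((n + k) choose k)"
    by (simp only: of_nat_mult of_nat_Suc of_nat_add add_Suc_right add.commute add.left_commute)
  have "(int k + 1)\<^sup>2 * legendre_coeff n (Suc k)
      = - ((- 1) ^ k) * ((int k + 1) * int (n choose Suc k)) * ((int k + 1) * int ((n + Suc k) choose Suc k))"
    unfolding legendre_coeff_def by (simp add: power2_eq_square)
  also have "\<dots> = (int k * (int k + 1) - int n * (int n + 1)) * legendre_coeff n k"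
    unfolding 1 2 legendre_coeff_def by (simp add: algebra_simps)
  finally show ?thesis .
qed

lemma central_binomial_rec:
  "(int k + 1) * int ((2 * Suc k) choose Suc k) = 2 * (2 * int k + 1) * int ((2 * k) choose k)"
proof -
  have 1: "Suc k * (Suc (Suc (2 * k)) choose Suc k) = Suc (Suc (2 * k)) * (Suc (2 * k) choose k)"
    using Suc_times_binomial_eq[of "Suc (2 * k)" k] by (simp add: mult.commute)
  have 2: "Suc k * (Suc (2 * k) choose Suc k) = Suc (2 * k) * ((2 * k) choose k)"
    using Suc_times_binomial_eq[of "2 * k" k] by (simp add: mult.commute)
  have "Suc (2 * k) choose k = Suc (2 * k) choose Suc k"
    using binomial_symmetric[of k "Suc (2 * k)"] by simp
  with 1 have "Suc k * (Suc (Suc (2 * k)) choose Suc k) = 2 * (Suc k * (Suc (2 * k) choose Suc k))"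
    by (simp del: binomial_Suc_Suc)
  then have "Suc k * (Suc (Suc (2 * k)) choose Suc k) = 2 * (Suc (2 * k) * ((2 * k) choose k))"
    by (simp only: 2)
  then have "int (Suc k * (Suc (Suc (2 * k)) choose Suc k)) = int (2 * (Suc (2 * k) * ((2 * k) choose k)))"
    by (simp only:)
  then show ?thesis by (simp add: algebra_simps)
qed

text \<open>Used with \<open>c = k + 1\<close> to divide a recurrence by its leading factor:
  \<open>i = 2\<close> for squared binomials, \<open>i = 1\<close> for plain ones.\<close>

lemma cong_cancel_coprime:
  fixes c :: int
  assumes "prime p" "0 < c" "c < int p" "[c ^ i * a = c ^ i * b] (mod int p ^ m)"
  shows "[a = b] (mod int p ^ m)"
proof -
  have "\<not> int p dvd c" using assms(2,3) zdvd_imp_le by fastforce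
  then have "coprime c (int p)"
    using assms(1) by (metis coprime_commute prime_imp_coprime prime_nat_int_transfer)
  then show ?thesis using assms(4) by (simp add: cong_mult_lcancel)
qed

text \<open>Both sides satisfy first-order recurrences with leading factor \<open>(k + 1)^2\<close>,
  and their multipliers differ by a multiple of \<open>p^2\<close>: since \<open>p = 2n + 1\<close>,
  \<open>16 (k(k + 1) - n(n + 1)) = 4 (2k + 1)^2 - 4 p^2\<close>.\<close>

lemma central_binomial_sq_cong:
  assumes "prime p" "p = 2 * n + 1" "k < p"
  shows "[int ((2 * k) choose k) ^ 2 = 16 ^ k * legendre_coeff n k] (mod int p ^ 2)"
  using assms(3)
proof (induction k)
  case 0
  then show ?case by (simp add: legendre_coeff_def)
next
  case (Suc k)
  let ?c = "int ((2 * k) choose k)" and ?f = "legendre_coeff n k"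
  have "(int k + 1)\<^sup>2 * int ((2 * Suc k) choose Suc k) ^ 2
      = ((int k + 1) * int ((2 * Suc k) choose Suc k))\<^sup>2" by (simp add: power_mult_distrib)
  also have "\<dots> = 4 * (2 * int k + 1)\<^sup>2 * ?c\<^sup>2"
    unfolding central_binomial_rec power_mult_distrib by simp
  also have "[\<dots> = 4 * (2 * int k + 1)\<^sup>2 * (16 ^ k * ?f)] (mod int p ^ 2)"
    by (intro cong_scalar_left Suc.IH) (use Suc.prems in simp)
  also have "[4 * (2 * int k + 1)\<^sup>2 * (16 ^ k * ?f)
      = 4 * (2 * int k + 1)\<^sup>2 * (16 ^ k * ?f) + int p ^ 2 * (- 4 * 16 ^ k * ?f)] (mod int p ^ 2)"
    by (simp add: cong_iff_dvd_diff)
  also have "4 * (2 * int k + 1)\<^sup>2 * (16 ^ k * ?f) + int p ^ 2 * (- 4 * 16 ^ k * ?f)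
      = 16 ^ Suc k * ((int k * (int k + 1) - int n * (int n + 1)) * ?f)"
    using assms(2) by (simp add: power2_eq_square algebra_simps)
  also have "\<dots> = (int k + 1)\<^sup>2 * (16 ^ Suc k * legendre_coeff n (Suc k))"
    by (simp only: legendre_coeff_rec[symmetric] mult.left_commute)
  finally show ?case
    by (rule cong_cancel_coprime[OF assms(1), rotated 2]) (use Suc.prems in auto)
qed

text \<open>Again a comparison of recurrences: \<open>-4 (n - k) = 2 (2k + 1) - 2p\<close>.\<close>

lemma central_binomial_cong:
  assumes "prime p" "p = 2 * n + 1" "k < p"
  shows "[int ((2 * k) choose k) = (- 4) ^ k * int (n choose k)] (mod int p)"
  using assms(3)
proof (induction k)
  case 0
  then show ?case by simp
next
  case (Suc k)
  let ?c = "int ((2 * k) choose k)" and ?g = "int (n choose k)"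
  have "(int k + 1) * int ((2 * Suc k) choose Suc k) = 2 * (2 * int k + 1) * ?c"
    by (rule central_binomial_rec)
  also have "[\<dots> = 2 * (2 * int k + 1) * ((- 4) ^ k * ?g)] (mod int p)"
    by (intro cong_scalar_left Suc.IH) (use Suc.prems in simp)
  also have "[2 * (2 * int k + 1) * ((- 4) ^ k * ?g)
      = 2 * (2 * int k + 1) * ((- 4) ^ k * ?g) + int p * (- 2 * (- 4) ^ k * ?g)] (mod int p)"
    by (simp add: cong_iff_dvd_diff)
  also have "2 * (2 * int k + 1) * ((- 4) ^ k * ?g) + int p * (- 2 * (- 4) ^ k * ?g)
      = (- 4) ^ Suc k * ((int n - int k) * ?g)"
    using assms(2) by (simp add: algebra_simps)
  also have "\<dots> = (int k + 1) * ((- 4) ^ Suc k * int (n choose Suc k))"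
    unfolding binomial_Suc_rec[symmetric] by (simp only: of_nat_Suc mult.left_commute add.commute)
  finally have "[(int k + 1) ^ 1 * int ((2 * Suc k) choose Suc k)
      = (int k + 1) ^ 1 * ((- 4) ^ Suc k * int (n choose Suc k))] (mod int p ^ 1)"
    by simp
  then have "[int ((2 * Suc k) choose Suc k) = (- 4) ^ Suc k * int (n choose Suc k)] (mod int p ^ 1)"
    by (rule cong_cancel_coprime[OF assms(1), rotated 2]) (use Suc.prems in auto)
  then show ?case by simp
qed

text \<open>For \<open>k \<le> n\<close> both are \<open>(2k choose k)^2 / 16^k\<close> modulo
  \<open>p\<close>, and \<open>16^k\<close> cancels because \<open>p\<close> is odd; for larger
  \<open>k\<close> both vanish.\<close>

lemma legendre_coeff_cong_binomial_sq:
  assumes "prime p" "p = 2 * n + 1"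
  shows "[legendre_coeff n k = int (n choose k) ^ 2] (mod int p)"
proof (cases "k \<le> n")
  case True
  then have "k < p" using assms(2) by simp
  have "[16 ^ k * legendre_coeff n k = int ((2 * k) choose k) ^ 2] (mod int p)"
    using central_binomial_sq_cong[OF assms \<open>k < p\<close>, THEN cong_sym]
    by (rule cong_dvd_modulus) simp
  also have "[int ((2 * k) choose k) ^ 2 = ((- 4) ^ k * int (n choose k)) ^ 2] (mod int p)"
    by (intro cong_pow central_binomial_cong assms \<open>k < p\<close>)
  also have "((- 4) ^ k * int (n choose k)) ^ 2 = 16 ^ k * int (n choose k) ^ 2"
    by (simp add: power_mult_distrib flip: power_mult) (simp add: power_mult mult.commute[of k])
  finally have "[16 ^ k * legendre_coeff n k = 16 ^ k * int (n choose k) ^ 2] (mod int p)" .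
  moreover have "coprime 2 (int p)" using assms(2) by simp
  then have "coprime (2 ^ 4) (int p)" by (subst coprime_power_left_iff) simp
  then have "coprime (16 ^ k) (int p)" by simp
  ultimately show ?thesis by (simp add: cong_mult_lcancel)
qed (simp add: legendre_coeff_def binomial_eq_0)

section \<open>Shifted Legendre polynomials\<close>

definition legendre_poly :: "nat \<Rightarrow> int poly" where
  "legendre_poly n = (\<Sum>k\<le>n. monom (legendre_coeff n k) k)"

text \<open>For \<open>n = (p - 1) / 2\<close>, its reduction modulo \<open>p\<close> is Deuring's
  polynomial, whose zeros are the supersingular parameters of the Legendre family of elliptic
  curves.\<close>

definition binomial_sq_poly :: "nat \<Rightarrow> int poly" where
  "binomial_sq_poly n = (\<Sum>k\<le>n. monom (int (n choose k) ^ 2) k)"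

lemma coeff_legendre_poly [simp]: "coeff (legendre_poly n) k = legendre_coeff n k"
proof -
  have "coeff (legendre_poly n) k = (\<Sum>i\<le>n. if i = k then legendre_coeff n i else 0)"
    unfolding legendre_poly_def by (simp add: coeff_sum)
  then show ?thesis by (auto simp: legendre_coeff_def binomial_eq_0)
qed

lemma coeff_binomial_sq_poly [simp]: "coeff (binomial_sq_poly n) k = int (n choose k) ^ 2"
proof -
  have "coeff (binomial_sq_poly n) k = (\<Sum>i\<le>n. if i = k then int (n choose i) ^ 2 else 0)"
    unfolding binomial_sq_poly_def by (simp add: coeff_sum)
  then show ?thesis by (auto simp: binomial_eq_0)
qed

lemma poly_legendre_poly: "poly (legendre_poly n) x = (\<Sum>k\<le>n. legendre_coeff n k * x ^ k)"
  unfolding legendre_poly_def by (simp add: poly_sum poly_monom)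

lemma pderiv_sum: "pderiv (sum f A) = (\<Sum>k\<in>A. pderiv (f k))"
  by (induction A rule: infinite_finite_induct) (simp_all add: pderiv_add)

lemma poly_pderiv_legendre_poly:
  "x * poly (pderiv (legendre_poly n)) x = (\<Sum>k\<le>n. int k * legendre_coeff n k * x ^ k)"
proof -
  have "x * (of_nat k * c * x ^ (k - 1)) = of_nat k * c * x ^ k" for k and c :: int
    by (cases k) auto
  then show ?thesis
    unfolding legendre_poly_def
    by (simp only: pderiv_sum pderiv_monom poly_sum poly_monom sum_distrib_left)
qed

lemma degree_legendre_poly: "degree (legendre_poly n) = n"
proof (rule antisym)
  show "degree (legendre_poly n) \<le> n"
    by (rule degree_le) (auto simp: legendre_coeff_def binomial_eq_0)
  show "n \<le> degree (legendre_poly n)"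
    by (rule le_degree) (simp add: legendre_coeff_def)
qed

lemma degree_binomial_sq_poly: "degree (binomial_sq_poly n) \<le> n"
  by (rule degree_le) (auto simp: binomial_eq_0)

section \<open>Differential equations of F and G, and the reflection x -> 1 - x\<close>

lemma coeff_Legendre_operator:
  fixes y :: "int poly"
  shows "coeff (pderiv ([:0, 1, -1:] * pderiv y)) k
    = (int k + 1)\<^sup>2 * coeff y (Suc k) - int k * (int k + 1) * coeff y k"
  by (cases k) (simp_all add: coeff_pderiv power2_eq_square algebra_simps)

lemma legendre_poly_ODE:
  "pderiv ([:0, 1, -1:] * pderiv (legendre_poly n))
     = smult (- (int n * (int n + 1))) (legendre_poly n)"
  by (rule poly_eqI)
    (simp only: coeff_Legendre_operator coeff_smult coeff_legendre_poly legendre_coeff_rec,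
     simp add: algebra_simps)

text \<open>An exact identity, in which \<open>p\<close> only stands for \<open>2n + 1\<close>:
  coefficientwise it reads \<open>(n - k)^2 - k(k + 1) = n^2 - p k\<close>. Since
  \<open>n^2 = -n(n + 1) + n p\<close>, it agrees with the Legendre equation modulo
  \<open>p\<close>.\<close>

lemma binomial_sq_poly_ODE:
  assumes "p = 2 * n + 1"
  shows "pderiv ([:0, 1, -1:] * pderiv (binomial_sq_poly n))
     = smult (int n ^ 2) (binomial_sq_poly n) - smult (int p) ([:0, 1:] * pderiv (binomial_sq_poly n))"
proof (rule poly_eqI)
  fix k
  let ?G = "binomial_sq_poly n"
  have "(int k + 1)\<^sup>2 * int (n choose Suc k) ^ 2 = ((int n - int k) * int (n choose k))\<^sup>2"
    unfolding binomial_Suc_rec[symmetric] by (simp only: power_mult_distrib of_nat_Suc add.commute)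
  then have *: "(int k + 1)\<^sup>2 * int (n choose Suc k) ^ 2 = (int n - int k)\<^sup>2 * int (n choose k) ^ 2"
    by (simp only: power_mult_distrib)
  have "coeff (pderiv ([:0, 1, -1:] * pderiv ?G)) k
      = ((int n - int k)\<^sup>2 - int k * (int k + 1)) * int (n choose k) ^ 2"
    unfolding coeff_Legendre_operator coeff_binomial_sq_poly *
    by (simp only: left_diff_distrib)
  moreover have "coeff ([:0, 1:] * pderiv ?G) k = int k * int (n choose k) ^ 2"
    by (cases k) (simp_all add: coeff_pderiv)
  ultimately show "coeff (pderiv ([:0, 1, -1:] * pderiv ?G)) k
      = coeff (smult (int n ^ 2) ?G - smult (int p) ([:0, 1:] * pderiv ?G)) k"
    unfolding coeff_diff coeff_smult coeff_binomial_sq_poly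
    using assms by (simp add: power2_eq_square algebra_simps)
qed

text \<open>The equation gives a recurrence whose leading factor \<open>(k + 1)^2\<close> never
  vanishes, so the constant term determines a polynomial solution.\<close>

lemma Legendre_ODE_unique:
  assumes "pderiv ([:0, 1, -1:] * pderiv y) = smult (- (int n * (int n + 1))) y"
  shows "y = smult (coeff y 0) (legendre_poly n)"
proof (rule poly_eqI)
  fix k
  have rec: "(int k + 1)\<^sup>2 * coeff y (Suc k)
      = (int k * (int k + 1) - int n * (int n + 1)) * coeff y k" for k
    using arg_cong[OF assms, of "\<lambda>q. coeff q k"] unfolding coeff_Legendre_operator coeff_smult
    by (simp add: algebra_simps)
  have "coeff y k = coeff y 0 * legendre_coeff n k"
  proof (induction k)
    case 0
    then show ?case by (simp add: legendre_coeff_def)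
  next
    case (Suc k)
    have "(int k + 1)\<^sup>2 * coeff y (Suc k) = (int k + 1)\<^sup>2 * (coeff y 0 * legendre_coeff n (Suc k))"
      using rec[of k] legendre_coeff_rec[of k n] Suc.IH by (simp add: mult.left_commute)
    then show ?case by simp
  qed
  then show "coeff y k = coeff (smult (coeff y 0) (legendre_poly n)) k" by simp
qed

text \<open>The substitution \<open>x -> 1 - x\<close> fixes \<open>x(1 - x)\<close> and changes the
  sign of each of the two derivatives, so \<open>R\<close> solves the same equation and is a
  multiple of \<open>F\<close>. The multiple is found from the leading coefficients, as the constant
  term of \<open>R\<close> is the unknown value \<open>F(1)\<close>.\<close>

lemma legendre_poly_reflect:
  "pcompose (legendre_poly n) [:1, -1:] = smult ((- 1) ^ n) (legendre_poly n)"
proof -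
  let ?F = "legendre_poly n" and ?r = "[:1, -1:] :: int poly"
  define R where "R = pcompose ?F ?r"
  have r: "pderiv (pcompose q ?r) = - pcompose (pderiv q) ?r" for q :: "int poly"
    by (simp add: pderiv_pcompose pderiv_pCons)
  have "pcompose [:0, 1, -1:] ?r = ([:0, 1, -1:] :: int poly)" by (simp add: pcompose_pCons)
  then have "[:0, 1, -1:] * pderiv R = - pcompose ([:0, 1, -1:] * pderiv ?F) ?r"
    by (simp only: R_def r pcompose_mult mult_minus_right)
  then have "pderiv ([:0, 1, -1:] * pderiv R) = pcompose (pderiv ([:0, 1, -1:] * pderiv ?F)) ?r"
    by (simp only: r pderiv_minus minus_minus)
  then have "pderiv ([:0, 1, -1:] * pderiv R) = smult (- (int n * (int n + 1))) R"
    by (simp only: legendre_poly_ODE pcompose_smult R_def)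
  then have R: "R = smult (coeff R 0) ?F" by (rule Legendre_ODE_unique)
  have nz: "legendre_coeff n n \<noteq> 0" by (simp add: legendre_coeff_def)
  have "lead_coeff R = legendre_coeff n n * (- 1) ^ n"
    unfolding R_def by (subst lead_coeff_comp) (simp_all add: degree_legendre_poly)
  moreover have "degree R = n" by (simp add: R_def degree_pcompose degree_legendre_poly)
  ultimately have "coeff R n = legendre_coeff n n * (- 1) ^ n" by simp
  moreover have "coeff R n = coeff R 0 * legendre_coeff n n"
    using arg_cong[OF R, of "\<lambda>q. coeff q n"] by simp
  ultimately have "coeff R 0 = (- 1) ^ n" using nz by simp
  with R show ?thesis unfolding R_def by (simp only:)
qed

lemma poly_legendre_poly_reflect:
  "odd n \<Longrightarrow> poly (legendre_poly n) (1 - x) = - poly (legendre_poly n) x"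
  using arg_cong[OF legendre_poly_reflect[of n], of "\<lambda>q. poly q x"] by (simp add: poly_pcompose)

lemma poly_pderiv_legendre_poly_reflect:
  "odd n \<Longrightarrow> poly (pderiv (legendre_poly n)) (1 - x) = poly (pderiv (legendre_poly n)) x"
  using arg_cong[OF legendre_poly_reflect[of n], of "\<lambda>q. poly (pderiv q) x"]
  by (simp add: poly_pcompose pderiv_pcompose pderiv_pCons pderiv_minus pderiv_smult)

section \<open>Reduction of polynomials and the Wronskian modulo p^2\<close>

lemma coeff_mult_degree_bound:
  fixes a b :: "'a :: comm_semiring_0 poly"
  assumes "degree a \<le> i" "degree b \<le> j"
  shows "coeff (a * b) (i + j) = coeff a i * coeff b j"
proof -
  have "coeff (a * b) (i + j) = (\<Sum>k\<le>i + j. coeff a k * coeff b (i + j - k))"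
    by (rule coeff_mult)
  also have "\<dots> = (\<Sum>k\<in>{i}. coeff a k * coeff b (i + j - k))"
  proof (rule sum.mono_neutral_right)
    show "\<forall>k\<in>{..i + j} - {i}. coeff a k * coeff b (i + j - k) = 0"
    proof
      fix k assume "k \<in> {..i + j} - {i}"
      then have "degree a < k \<or> degree b < i + j - k" using assms by auto
      then show "coeff a k * coeff b (i + j - k) = 0" by (auto simp: coeff_eq_0)
    qed
  qed auto
  finally show ?thesis by simp
qed

lemma poly_cong_if_dvd:
  fixes P Q :: "int poly"
  assumes "[:c:] dvd P - Q"
  shows "[poly P x = poly Q x] (mod c)"
proof -
  obtain R where "P - Q = [:c:] * R" using assms by blast
  then have "poly (P - Q) x = poly ([:c:] * R) x" by simp
  then show ?thesis by (simp add: cong_iff_dvd_diff)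
qed

lemma poly_pderiv_cong_if_dvd:
  fixes P Q :: "int poly"
  assumes "[:c:] dvd P - Q"
  shows "[poly (pderiv P) x = poly (pderiv Q) x] (mod c)"
proof (rule poly_cong_if_dvd)
  obtain R where "P - Q = [:c:] * R" using assms by blast
  then have "pderiv (P - Q) = pderiv (smult c R)" by simp
  then have "pderiv P - pderiv Q = [:c:] * pderiv R" by (simp add: pderiv_diff pderiv_smult)
  then show "[:c:] dvd pderiv P - pderiv Q" by (rule dvdI)
qed

lemma legendre_poly_cong_binomial_sq_poly:
  assumes "prime p" "p = 2 * n + 1"
  shows "[:int p:] dvd legendre_poly n - binomial_sq_poly n"
  unfolding const_poly_dvd_iff
  using legendre_coeff_cong_binomial_sq[OF assms] by (simp add: cong_iff_dvd_diff)

lemma Wronskian_cong: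
  assumes "prime p" "p = 2 * n + 1" "n \<ge> 1"
  defines "F \<equiv> legendre_poly n" and "G \<equiv> binomial_sq_poly n"
  shows "[:int p ^ 2:] dvd
    smult 2 ([:0, 1, -1:] * (pderiv G * F - G * pderiv F)) + smult (int p) ([:0, 1:] * F ^ 2)
    - monom (int p) p"
proof -
  define Q :: "int poly" where "Q = [:0, 1, -1:]"
  define X :: "int poly" where "X = [:0, 1:]"
  define W where "W = Q * (pderiv G * F - G * pderiv F)"
  define V where "V = smult 2 W + smult (int p) (X * F ^ 2)"
  have [simp]: "pderiv X = 1" by (simp add: X_def pderiv_pCons)
  \<comment> \<open>In this grouping the product rule produces \<open>Q G' F'\<close> twice with
    opposite signs, leaving only the two operators of the differential equations.\<close>
  have W: "W = (Q * pderiv G) * F - G * (Q * pderiv F)" by (simp add: W_def algebra_simps)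
  have "pderiv W = pderiv (Q * pderiv G) * F - G * pderiv (Q * pderiv F)"
    unfolding W pderiv_diff pderiv_mult[of _ F] pderiv_mult[of G] by (simp add: algebra_simps)
  also have "\<dots> = smult (int p) (smult (int n) (F * G) - X * F * pderiv G)"
    \<comment> \<open>The coefficient of \<open>F G\<close> is \<open>n^2 + n(n + 1) = n p\<close>,
      which is where the first factor \<open>p\<close> appears.\<close>
    unfolding Q_def F_def G_def legendre_poly_ODE binomial_sq_poly_ODE[OF assms(2), folded X_def]
    by (rule poly_eqI) (simp add: assms(2) algebra_simps power2_eq_square)
  finally have dW: "pderiv W = smult (int p) (smult (int n) (F * G) - X * F * pderiv G)" .
  obtain R where R: "F - G = [:int p:] * R"
    using legendre_poly_cong_binomial_sq_poly[OF assms(1,2)] unfolding F_def G_def by blast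
  have F: "F = G + smult (int p) R" using R by (simp add: algebra_simps)
  have dF: "pderiv F = pderiv G + smult (int p) (pderiv R)"
    by (simp add: F pderiv_add pderiv_smult)
  \<comment> \<open>Scalars become constant polynomials, so that \<open>p = 2n + 1\<close> can be
    used as a ring identity.\<close>
  define P :: "int poly" where "P = [:int p:]"
  define N :: "int poly" where "N = [:int n:]"
  have PN: "P = 2 * N + 1"
    using assms(2) by (simp add: P_def N_def numeral_poly one_pCons)
  have smult_P: "smult (int p) q = P * q" for q by (simp add: P_def)
  have smult_N: "smult (int n) q = N * q" for q by (simp add: N_def)
  have "pderiv V = 2 * pderiv W + P * (F ^ 2 + X * (2 * F * pderiv F))"
    unfolding V_def smult_P[symmetric]
    by (simp add: pderiv_add pderiv_smult pderiv_mult power2_eq_square numeral_poly algebra_simps)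
  also have "\<dots> = P * (2 * N * (F * G) - 2 * X * F * pderiv G + F * F + 2 * X * F * pderiv F)"
    unfolding dW smult_P smult_N by (simp add: power2_eq_square algebra_simps)
  \<comment> \<open>Replacing one \<open>F\<close> by \<open>G + p R\<close> completes
    \<open>2N F G\<close> to \<open>(2N + 1) F G = P F G\<close>. Together with
    \<open>F' - G' = p R'\<close> this yields the second factor \<open>p\<close>.\<close>
  also have "F * F = F * G + F * (P * R)"
    using F by (simp only: smult_P distrib_left[symmetric])
  also have "P * (2 * N * (F * G) - 2 * X * F * pderiv G + (F * G + F * (P * R)) + 2 * X * F * pderiv F)
      = P * ((2 * N + 1) * (F * G) + P * (F * R) + 2 * X * F * (pderiv F - pderiv G))"
    by (simp add: algebra_simps)
  also have "\<dots> = P * (P * (F * G + F * R + 2 * X * F * pderiv R))"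
    unfolding PN[symmetric] dF smult_P by (simp add: algebra_simps)
  also have "\<dots> = smult (int p) (smult (int p) (F * G + F * R + 2 * X * F * pderiv R))"
    by (simp only: smult_P)
  finally have dV: "pderiv V = smult (int p ^ 2) (F * G + F * R + 2 * X * F * pderiv R)"
    by (simp add: power2_eq_square)
  have degF: "degree F \<le> n" and degG: "degree G \<le> n"
    by (simp_all add: F_def G_def degree_legendre_poly degree_binomial_sq_poly)
  have degdF: "degree (pderiv F) \<le> n - 1" and degdG: "degree (pderiv G) \<le> n - 1"
    using degF degG by (simp_all add: degree_pderiv)
  have degs: "degree (pderiv G * F) \<le> n - 1 + n" "degree (G * pderiv F) \<le> n + (n - 1)"
    using degF degG degdF degdG by (meson add_mono degree_mult_le order_trans)+
  \<comment> \<open>The top terms \<open>n g_n f_n\<close> of the two products cancel, so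
    \<open>W\<close> contributes nothing to \<open>x^p\<close> and that coefficient of
    \<open>V\<close> comes from \<open>p x F^2\<close> alone.\<close>
  have "coeff (pderiv G * F - G * pderiv F) (n - 1 + n) = 0"
    using coeff_mult_degree_bound[OF degdG degF] coeff_mult_degree_bound[OF degG degdF] assms(3)
    by (simp add: coeff_pderiv add.commute)
  moreover have degD: "degree (pderiv G * F - G * pderiv F) \<le> n - 1 + n"
    using degs by (intro degree_diff_le) simp_all
  ultimately have "coeff W (2 + (n - 1 + n)) = 0"
    unfolding W_def by (subst coeff_mult_degree_bound) (simp_all add: Q_def)
  then have "coeff W p = 0" using assms(2,3) by (simp add: numeral_eq_Suc)
  moreover have degF2: "degree (F ^ 2) \<le> n + n"
    unfolding power2_eq_square using degF by (meson add_mono degree_mult_le order_trans)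
  then have "coeff (X * F ^ 2) (1 + (n + n)) = coeff (F ^ 2) (n + n)"
    by (subst coeff_mult_degree_bound) (simp_all add: X_def)
  moreover have "coeff (F ^ 2) (n + n) = (coeff F n)\<^sup>2"
    unfolding power2_eq_square using degF by (intro coeff_mult_degree_bound)
  moreover have "1 + (n + n) = p" using assms(2) by simp
  ultimately have Vp: "coeff V p = int p * (legendre_coeff n n)\<^sup>2"
    unfolding V_def by (simp only: coeff_add coeff_smult mult_zero_right add_0 F_def coeff_legendre_poly)
  have degV: "degree V \<le> p"
  proof -
    have "degree W \<le> 2 + (n - 1 + n)"
      unfolding W_def
      by (rule order_trans[OF degree_mult_le], rule add_mono) (use degD in \<open>simp_all add: Q_def\<close>)
    moreover have "degree (X * F ^ 2) \<le> 1 + (n + n)"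
      by (rule order_trans[OF degree_mult_le], rule add_mono) (use degF2 in \<open>simp_all add: X_def\<close>)
    moreover have "2 + (n - 1 + n) = p" "1 + (n + n) = p" using assms(2,3) by simp_all
    ultimately show ?thesis unfolding V_def
      by (intro degree_add_le) (auto intro: order_trans[OF degree_smult_le])
  qed
  \<comment> \<open>The derivative controls the coefficients with \<open>0 < k < p\<close>, as
    \<open>k\<close> is then invertible modulo \<open>p^2\<close>. At \<open>k = p\<close> this
    fails, and the explicit coefficient \<open>p f_n^2\<close> with \<open>f_n^2 \<equiv> 1\<close>
    modulo \<open>p\<close> is used instead.\<close>
  have "int p ^ 2 dvd coeff (V - monom (int p) p) k" for k
  proof -
    consider "k = 0" | "0 < k" "k < p" | "k = p" | "k > p" by linarith
    then show ?thesis
    proof cases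
      case 1
      then show ?thesis using assms(2) by (simp add: V_def W_def Q_def X_def coeff_mult)
    next
      case 2
      then obtain j where j: "k = Suc j" by (cases k) auto
      have "int k * coeff V k = coeff (pderiv V) j" by (simp add: coeff_pderiv j)
      then have "int p ^ 2 dvd int k * coeff V k" by (simp add: dV)
      moreover have "\<not> int p dvd int k" using 2 by (simp add: nat_dvd_not_less)
      then have "coprime (int p ^ 2) (int k)"
        using assms(1) by (simp add: prime_imp_coprime)
      ultimately have "int p ^ 2 dvd coeff V k" by (simp add: coprime_dvd_mult_right_iff)
      then show ?thesis using 2 by simp
    next
      case 3
      have "[(legendre_coeff n n)\<^sup>2 = (int (n choose n) ^ 2)\<^sup>2] (mod int p)"
        by (intro cong_pow legendre_coeff_cong_binomial_sq assms)
      then have "int p dvd (legendre_coeff n n)\<^sup>2 - 1" by (simp add: cong_iff_dvd_diff)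
      then have "int p * int p dvd int p * ((legendre_coeff n n)\<^sup>2 - 1)" by simp
      then show ?thesis using 3 by (simp add: Vp power2_eq_square algebra_simps)
    next
      case 4
      then show ?thesis using degV by (simp add: coeff_eq_0)
    qed
  qed
  then show ?thesis unfolding const_poly_dvd_iff V_def W_def Q_def X_def by blast
qed

section \<open>Special values and sums\<close>

lemma coeff_one_plus_linear_power:
  fixes c :: int
  shows "coeff ([:1, c:] ^ n) i = int (n choose i) * c ^ i"
proof (cases "i \<le> n")
  case True
  then show ?thesis by (simp add: coeff_linear_poly_power)
next
  case False
  have "degree ([:1, c:] ^ n) \<le> n"
    by (rule order_trans[OF degree_power_le]) simp
  with False show ?thesis by (simp add: coeff_eq_0 binomial_eq_0)
qed

lemma coeff_one_plus_square_power:
  fixes c :: int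
  shows "coeff ([:1, 0, c:] ^ n) i = (if even i then int (n choose (i div 2)) * c ^ (i div 2) else 0)"
proof -
  have "[:1, 0, c:] = monom c 2 + 1"
    by (simp add: monom_altdef numeral_eq_Suc one_pCons)
  then have "[:1, 0, c:] ^ n = (\<Sum>k\<le>n. of_nat (n choose k) * monom (c ^ k) (2 * k))"
    by (simp add: binomial_ring monom_power mult.commute)
  then have "coeff ([:1, 0, c:] ^ n) i
      = (\<Sum>k\<le>n. if 2 * k = i then int (n choose k) * c ^ k else 0)"
    by (simp add: coeff_sum of_nat_poly) (rule sum.cong, auto)
  also have "\<dots> = (if even i then int (n choose (i div 2)) * c ^ (i div 2) else 0)"
  proof (cases "even i")
    case True
    then obtain j where "i = 2 * j" by blast
    then show ?thesis by (auto simp: binomial_eq_0)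
  next
    case False
    then have "2 * k \<noteq> i" for k by auto
    with False show ?thesis by simp
  qed
  finally show ?thesis .
qed

text \<open>The terms for \<open>k\<close> and \<open>n - k\<close> are opposite when
  \<open>n\<close> is odd.\<close>

lemma poly_binomial_sq_poly_minus_one:
  assumes "odd n"
  shows "poly (binomial_sq_poly n) (- 1) = 0"
proof -
  let ?h = "\<lambda>k. int (n choose k) ^ 2 * (- 1) ^ k"
  have P: "poly (binomial_sq_poly n) (- 1) = (\<Sum>k\<le>n. ?h k)"
    unfolding binomial_sq_poly_def by (simp add: poly_sum poly_monom)
  also have "\<dots> = (\<Sum>k\<le>n. ?h (n - k))"
    by (rule sum.reindex_bij_witness[of _ "\<lambda>k. n - k" "\<lambda>k. n - k"]) auto
  also have "\<dots> = (\<Sum>k\<le>n. - ?h k)"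
  proof (rule sum.cong)
    fix k assume "k \<in> {..n}"
    then have "(- 1 :: int) ^ (n - k) = - ((- 1) ^ k)" "n choose (n - k) = n choose k"
      using assms by (auto simp: minus_one_power_iff binomial_symmetric[symmetric])
    then show "?h (n - k) = - ?h k" by simp
  qed simp
  finally show ?thesis using P by (simp add: sum_negf)
qed

text \<open>Absorbing \<open>k\<close> by \<open>k (n choose k) = n (2j choose k - 1)\<close> and
  reflecting the other binomial makes the sum \<open>n\<close> times the coefficient of
  \<open>x^(2j)\<close> in \<open>(1 - x)^(2j) (1 + x)^n = (1 - x^2)^(2j) (1 + x)\<close>. Only the
  summand \<open>1\<close> of the last factor contributes to this even power.\<close>

lemma poly_pderiv_binomial_sq_poly_minus_one:
  assumes "n = 2 * j + 1"
  shows "poly (pderiv (binomial_sq_poly n)) (- 1) = (- 1) ^ j * int n * int ((2 * j) choose j)"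
proof -
  have odd_part: "coeff (pCons 0 ([:1, 0, -1:] ^ N :: int poly)) (2 * j) = 0" for N
    by (cases j) (simp_all add: coeff_one_plus_square_power)
  have "poly (pderiv (binomial_sq_poly n)) (- 1)
      = (\<Sum>k\<le>n. int k * int (n choose k) ^ 2 * (- 1) ^ (k - 1))"
    unfolding binomial_sq_poly_def
    by (simp add: pderiv_sum pderiv_monom poly_sum poly_monom)
  also have "\<dots> = (\<Sum>i\<le>2 * j. int (Suc i) * int (n choose Suc i) ^ 2 * (- 1) ^ i)"
    unfolding assms Suc_eq_plus1[symmetric] sum.atMost_Suc_shift by (simp del: binomial_Suc_Suc)
  also have "\<dots> = (\<Sum>i\<le>2 * j. int n * (int ((2 * j) choose i) * (- 1) ^ i * int (n choose (2 * j - i))))"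
  proof (rule sum.cong)
    fix i assume "i \<in> {..2 * j}"
    then have "n choose Suc i = n choose (2 * j - i)"
      using binomial_symmetric[of "Suc i" n] assms by simp
    moreover have "Suc i * (n choose Suc i) = n * ((2 * j) choose i)"
      using Suc_times_binomial_eq[of "2 * j" i] assms by (simp add: mult.commute)
    then have "int (Suc i) * int (n choose Suc i) = int n * int ((2 * j) choose i)"
      by (metis of_nat_mult)
    ultimately show "int (Suc i) * int (n choose Suc i) ^ 2 * (- 1) ^ i
        = int n * (int ((2 * j) choose i) * (- 1) ^ i * int (n choose (2 * j - i)))"
      by (simp add: power2_eq_square)
  qed simp
  also have "\<dots> = int n * (\<Sum>i\<le>2 * j. coeff ([:1, -1:] ^ (2 * j)) i * coeff ([:1, 1:] ^ n) (2 * j - i))"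
    by (simp add: coeff_one_plus_linear_power sum_distrib_left)
  also have "\<dots> = int n * coeff ([:1, -1:] ^ (2 * j) * [:1, 1:] ^ n) (2 * j)"
    by (simp only: coeff_mult)
  also have "[:1, -1:] ^ (2 * j) * [:1, 1:] ^ n = ([:1, -1:] * [:1, 1:]) ^ (2 * j) * ([:1, 1:] :: int poly)"
    by (simp only: assms power_add power_one_right power_mult_distrib mult.assoc)
  also have "[:1, -1:] * [:1, 1:] = ([:1, 0, -1:] :: int poly)" by simp
  also have "[:1, 0, -1:] ^ (2 * j) * [:1, 1:]
      = [:1, 0, -1:] ^ (2 * j) + pCons 0 ([:1, 0, -1:] ^ (2 * j) :: int poly)"
    by (simp add: mult.commute)
  also have "coeff \<dots> (2 * j) = (- 1) ^ j * int ((2 * j) choose j)"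
    by (simp add: coeff_one_plus_square_power odd_part)
  finally show ?thesis by simp
qed

text \<open>The sum is the coefficient of the odd power \<open>x^(n + d)\<close> in
  \<open>(2x - (1 + x)^2)^n\<close>, a polynomial in \<open>x^2\<close>. The factor
  \<open>x^(n - k)\<close> of the \<open>k\<close>-th term moves the index to
  \<open>n + d - (n - k) = k + d\<close>.\<close>

lemma sum_binomial_shifted_eq_0:
  assumes "odd (n + d)"
  shows "(\<Sum>k\<le>n. (- 1) ^ k * int (n choose k) * 2 ^ (n - k) * int ((2 * k) choose (k + d))) = 0"
proof -
  have "(- ([:1, 1:] ^ 2) + monom 2 1) = - ([:1, 0, 1:] :: int poly)"
    by (simp add: power2_eq_square monom_altdef)
  then have "(- [:1, 0, 1:] :: int poly) ^ n = (- ([:1, 1:] ^ 2) + monom 2 1) ^ n"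
    by (simp only:)
  also have "\<dots> = (\<Sum>k\<le>n. of_nat (n choose k) * (- ([:1, 1:] ^ 2)) ^ k * monom 2 1 ^ (n - k))"
    by (rule binomial_ring)
  also have "\<dots> = (\<Sum>k\<le>n. smult ((- 1) ^ k * int (n choose k)) (monom (2 ^ (n - k)) (n - k) * [:1, 1:] ^ (2 * k)))"
  proof (rule sum.cong)
    fix k
    have "(- ([:1, 1:] ^ 2)) ^ k = smult ((- 1) ^ k) ([:1, 1:] ^ (2 * k) :: int poly)"
      by (cases "even k") (simp_all add: power_mult)
    then show "of_nat (n choose k) * (- ([:1, 1:] ^ 2)) ^ k * monom 2 1 ^ (n - k)
        = smult ((- 1) ^ k * int (n choose k)) (monom (2 ^ (n - k)) (n - k) * [:1, 1:] ^ (2 * k))"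
      by (simp add: of_nat_poly monom_power mult.commute)
  qed simp
  finally have "coeff ((- [:1, 0, 1:] :: int poly) ^ n) (n + d)
      = (\<Sum>k\<le>n. (- 1) ^ k * int (n choose k) * 2 ^ (n - k) * int ((2 * k) choose (k + d)))"
    by (simp add: coeff_sum coeff_monom_mult coeff_one_plus_linear_power mult.assoc)
      (rule sum.cong, auto simp: coeff_one_plus_linear_power add.commute)
  moreover have "coeff ((- [:1, 0, 1:] :: int poly) ^ n) (n + d) = 0"
    using assms by (subst power_minus)
      (cases "even n"; simp add: coeff_one_plus_square_power del: minus_pCons)
  ultimately show ?thesis by simp
qed

text \<open>The first claim is \<open>V \<equiv> p x^p\<close> at \<open>x = -1\<close>, the second
  is \<open>F' \<equiv> G'\<close> there; in both, \<open>G'(-1)\<close> is rewritten through the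
  binomial coefficient \<open>B\<close> of the theorem.\<close>

lemma legendre_poly_minus_one:
  assumes "prime p" "p = 2 * n + 1" "n = 2 * j + 1"
  shows "[(- 1) ^ j * int ((2 * Suc j) choose Suc j) * poly (legendre_poly n) (- 1) = 2 * int p]
    (mod int p ^ 2)"
    and "[8 * poly (pderiv (legendre_poly n)) (- 1) = (- 1) ^ j * int ((2 * Suc j) choose Suc j)]
    (mod int p)"
proof -
  let ?F = "legendre_poly n" and ?G = "binomial_sq_poly n" and ?B = "int ((2 * Suc j) choose Suc j)"
  define s where "s = poly ?F (- 1)"
  define D where "D = poly (pderiv ?G) (- 1)"
  have G0: "poly ?G (- 1) = 0" using assms(3) by (simp add: poly_binomial_sq_poly_minus_one)
  have dvd: "[:int p:] dvd ?F - ?G" by (rule legendre_poly_cong_binomial_sq_poly[OF assms(1,2)])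
  have "[s = 0] (mod int p)" using poly_cong_if_dvd[OF dvd, of "-1"] by (simp add: s_def G0)
  then have ps: "int p dvd s" by (simp add: cong_0_iff)
  \<comment> \<open>The passage to \<open>B\<close> costs a factor \<open>4 (j + 1) = p + 1\<close>,
    so \<open>8 D\<close> equals \<open>(-1)^j B\<close> only up to a multiple of
    \<open>p\<close>.\<close>
  have "8 * D = 4 * (- 1) ^ j * (2 * (2 * int j + 1) * int ((2 * j) choose j))"
    unfolding D_def poly_pderiv_binomial_sq_poly_minus_one[OF assms(3)] using assms(3) by simp
  also have "\<dots> = 4 * (- 1) ^ j * ((int j + 1) * ?B)" by (simp only: central_binomial_rec)
  also have "\<dots> = (- 1) ^ j * ?B + int p * ((- 1) ^ j * ?B)"
    using assms(2,3) by (simp add: algebra_simps del: binomial_Suc_Suc)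
  finally have D: "8 * D = (- 1) ^ j * ?B + int p * ((- 1) ^ j * ?B)" .
  have "odd p" using assms(2) by simp
  \<comment> \<open>Here \<open>x(1 - x) = -2\<close> and \<open>G(-1) = 0\<close>, so only
    \<open>G' F\<close> survives in the Wronskian; \<open>p x^p\<close> becomes \<open>-p\<close>
    because \<open>p\<close> is odd.\<close>
  have "[- (int p * s ^ 2) - 4 * (s * D) = - int p] (mod int p ^ 2)"
    using poly_cong_if_dvd[OF Wronskian_cong[OF assms(1,2)], of "-1"] assms(3) G0 \<open>odd p\<close>
    by (simp add: poly_monom s_def D_def algebra_simps)
  moreover have "int p ^ 2 dvd int p * s ^ 2"
    using ps by (simp add: power2_eq_square mult_dvd_mono)
  moreover have "int p ^ 2 dvd int p * ((- 1) ^ j * ?B) * s"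
    unfolding power2_eq_square using ps by (intro mult_dvd_mono) simp_all
  \<comment> \<open>Scaling by \<open>-2\<close> creates \<open>8 D s\<close>. As \<open>p\<close>
    divides \<open>s\<close>, both the \<open>p s^2\<close> term and the error
    \<open>p (-1)^j B s\<close> are multiples of \<open>p^2\<close>.\<close>
  ultimately have "int p ^ 2 dvd - 2 * (- (int p * s ^ 2) - 4 * (s * D) + int p)
      - 2 * (int p * s ^ 2) - int p * ((- 1) ^ j * ?B) * s"
    by (intro dvd_diff dvd_mult[of "int p ^ 2" _ "- 2"] dvd_mult[of "int p ^ 2" _ 2])
      (simp_all only: cong_iff_dvd_diff diff_minus_eq_add)
  also have "- 2 * (- (int p * s ^ 2) - 4 * (s * D) + int p)
      - 2 * (int p * s ^ 2) - int p * ((- 1) ^ j * ?B) * s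
      = (8 * D) * s - 2 * int p - int p * ((- 1) ^ j * ?B) * s"
    by (simp add: algebra_simps del: binomial_Suc_Suc)
  also have "\<dots> = (- 1) ^ j * ?B * s - 2 * int p"
    unfolding D by (simp add: algebra_simps del: binomial_Suc_Suc)
  finally show "[(- 1) ^ j * ?B * poly ?F (- 1) = 2 * int p] (mod int p ^ 2)"
    unfolding s_def cong_iff_dvd_diff .
  have "[8 * poly (pderiv ?F) (- 1) = 8 * D] (mod int p)"
    unfolding D_def by (intro cong_scalar_left poly_pderiv_cong_if_dvd dvd)
  also have "[8 * D = (- 1) ^ j * ?B] (mod int p)"
    unfolding D by (simp add: cong_iff_dvd_diff del: binomial_Suc_Suc)
  finally show "[8 * poly (pderiv ?F) (- 1) = (- 1) ^ j * ?B] (mod int p)" .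
qed

section \<open>The sums of the theorem as values of F and its derivative\<close>

lemma not_dvd_power_two: "prime p \<Longrightarrow> odd p \<Longrightarrow> \<not> int p dvd 2 ^ k"
  by (metis even_of_nat_iff prime_dvd_power prime_nat_int_transfer prime_int_not_dvd dvd_refl
      primes_dvd_imp_eq two_is_prime_nat of_nat_numeral zero_neq_one)

text \<open>Dividing by \<open>w^k\<close> instead of \<open>16^k\<close> amounts to multiplying by
  \<open>x^k\<close>; the weights \<open>8\<close> and \<open>-16\<close> correspond to
  \<open>x = 2\<close> and \<open>x = -1\<close>.\<close>

lemma weighted_term_cong:
  fixes w :: rat
  assumes "prime p" "p = 2 * n + 1" "k \<le> n" "w * of_int x = 16"
  shows "rat_cong p 2 (of_nat ((2 * k) choose k) ^ 2 / w ^ k) (of_int (legendre_coeff n k * x ^ k))"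
proof -
  have "odd p" "k < p" using assms(2,3) by simp_all
  have "\<not> int p dvd 2 ^ (4 * k)" using not_dvd_power_two[OF assms(1) \<open>odd p\<close>] .
  then have "\<not> int p dvd 16 ^ k" by (simp add: power_mult)
  then have "rat_cong p 2 (of_int (int ((2 * k) choose k) ^ 2) / of_int (16 ^ k)) (of_int (legendre_coeff n k))"
    by (intro rat_cong_divide central_binomial_sq_cong assms \<open>k < p\<close>)
  then have "rat_cong p 2 (of_int (x ^ k) * (of_int (int ((2 * k) choose k) ^ 2) / of_int (16 ^ k)))
      (of_int (x ^ k) * of_int (legendre_coeff n k))"
    by (intro rat_cong_mult_left p_integral_of_int assms)
  moreover have "of_int (x ^ k) * (of_int (int ((2 * k) choose k) ^ 2) / of_int (16 ^ k))
      = of_nat ((2 * k) choose k) ^ 2 / w ^ k"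
  proof -
    have "w \<noteq> 0" using assms(4) by auto
    moreover have "w ^ k * of_int x ^ k = 16 ^ k" using assms(4) by (simp flip: power_mult_distrib)
    ultimately show ?thesis by (simp add: field_simps)
  qed
  ultimately show ?thesis by (simp add: mult.commute)
qed

lemma sum_central_binomial_sq_cong:
  fixes w :: rat
  assumes "prime p" "p = 2 * n + 1" "w * of_int x = 16"
  shows "rat_cong p 2 (\<Sum>k = 0..n. of_nat ((2 * k) choose k) ^ 2 / w ^ k)
    (of_int (poly (legendre_poly n) x))"
proof -
  have "rat_cong p 2 (\<Sum>k = 0..n. of_nat ((2 * k) choose k) ^ 2 / w ^ k)
      (\<Sum>k = 0..n. of_int (legendre_coeff n k * x ^ k))"
    by (intro rat_cong_sum weighted_term_cong assms) auto
  then show ?thesis by (simp add: poly_legendre_poly atLeast0AtMost)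
qed

lemma sum_index_central_binomial_sq_cong:
  fixes w :: rat
  assumes "prime p" "p = 2 * n + 1" "w * of_int x = 16"
  shows "rat_cong p 1 (\<Sum>k = 0..n. of_nat k * of_nat ((2 * k) choose k) ^ 2 / w ^ k)
    (of_int (x * poly (pderiv (legendre_poly n)) x))"
proof -
  have "rat_cong p 1 (\<Sum>k = 0..n. of_nat k * (of_nat ((2 * k) choose k) ^ 2 / w ^ k))
      (\<Sum>k = 0..n. of_nat k * of_int (legendre_coeff n k * x ^ k))"
    by (intro rat_cong_sum rat_cong_mult_left rat_cong_weaken weighted_term_cong assms
        p_integral_of_nat) auto
  then show ?thesis
    unfolding poly_pderiv_legendre_poly by (simp add: atLeast0AtMost mult.assoc)
qed

text \<open>This is the Legendre equation integrated from \<open>0\<close> and divided by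
  \<open>x\<close>. It is proved termwise, from the recurrence divided by \<open>k + 1\<close>, and
  so holds at every \<open>x\<close>.\<close>

lemma sum_legendre_coeff_div_Suc:
  "of_nat n * (of_nat n + 1) * (\<Sum>k\<le>n. of_int (legendre_coeff n k * x ^ k) / (of_nat k + 1) :: rat)
     = of_int ((x - 1) * poly (pderiv (legendre_poly n)) x)"
proof -
  have *: "of_nat n * (of_nat n + 1) * (of_int (legendre_coeff n k * x ^ k) / (of_nat k + 1) :: rat)
      = of_int (int k * legendre_coeff n k * x ^ k) - of_int ((int k + 1) * legendre_coeff n (Suc k) * x ^ k)" for k
  proof -
    have "of_int ((int k + 1)\<^sup>2 * legendre_coeff n (Suc k))
       = (of_int ((int k * (int k + 1) - int n * (int n + 1)) * legendre_coeff n k) :: rat)"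
      by (simp only: legendre_coeff_rec)
    moreover have "(of_nat k + 1 :: rat) \<noteq> 0" by (metis of_nat_Suc of_nat_neq_0 add.commute)
    ultimately have "(of_nat k + 1) * of_int (legendre_coeff n (Suc k))
        = of_nat k * of_int (legendre_coeff n k)
          - of_nat n * (of_nat n + 1) * of_int (legendre_coeff n k) / (of_nat k + 1 :: rat)"
      by (simp add: divide_simps power2_eq_square) (simp add: algebra_simps)
    then show ?thesis by (simp add: left_diff_distrib)
  qed
  have d: "poly (pderiv (legendre_poly n)) x = (\<Sum>k\<le>n. (int k + 1) * legendre_coeff n (Suc k) * x ^ k)"
  proof -
    have "degree (pderiv (legendre_poly n)) \<le> n" by (simp add: degree_pderiv degree_legendre_poly)
    then have "poly (pderiv (legendre_poly n)) x = (\<Sum>k\<le>n. coeff (pderiv (legendre_poly n)) k * x ^ k)"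
      unfolding poly_altdef by (intro sum.mono_neutral_left) (auto simp: coeff_eq_0)
    then show ?thesis by (simp add: coeff_pderiv add.commute)
  qed
  have "of_int ((x - 1) * poly (pderiv (legendre_poly n)) x)
      = (of_int (x * poly (pderiv (legendre_poly n)) x - poly (pderiv (legendre_poly n)) x) :: rat)"
    by (simp add: algebra_simps)
  also have "\<dots> = (\<Sum>k\<le>n. of_int (int k * legendre_coeff n k * x ^ k)
      - of_int ((int k + 1) * legendre_coeff n (Suc k) * x ^ k))"
    unfolding poly_pderiv_legendre_poly by (subst d) (simp add: sum_subtractf)
  finally show ?thesis by (simp only: sum_distrib_left *)
qed

text \<open>The Catalan number supplies the factor \<open>1 / (k + 1)\<close>, which is
  \<open>p\<close>-integral because \<open>k + 1 < p\<close>. The resulting sum \<open>S\<close> is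
  then solved for by means of \<open>4 n (n + 1) = p^2 - 1\<close>.\<close>

lemma sum_central_binomial_catalan_cong:
  fixes w :: rat
  assumes "prime p" "p = 2 * n + 1" "w * of_int x = 16"
  shows "rat_cong p 1 (\<Sum>k = 0..n. of_nat ((2 * k) choose k) * catalan k / w ^ k)
    (of_int (4 * (1 - x) * poly (pderiv (legendre_poly n)) x))"
proof -
  define S where "S = (\<Sum>k\<le>n. of_int (legendre_coeff n k * x ^ k) / (of_nat k + 1) :: rat)"
  have inv: "p_integral p (1 / (of_nat k + 1))" if "k \<le> n" for k
  proof -
    have "\<not> int p dvd int (Suc k)" using that assms(2) prime_gt_1_nat[OF assms(1)]
      by (simp only: int_dvd_int_iff) (auto dest!: dvd_imp_le)
    from p_integral_inverse_of_int[OF this] show ?thesis by (simp add: add.commute)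
  qed
  have "rat_cong p 1 (\<Sum>k = 0..n. 1 / (of_nat k + 1) * (of_nat ((2 * k) choose k) ^ 2 / w ^ k))
      (\<Sum>k = 0..n. 1 / (of_nat k + 1) * of_int (legendre_coeff n k * x ^ k))"
    by (intro rat_cong_sum rat_cong_mult_left rat_cong_weaken weighted_term_cong assms inv) auto
  then have 1: "rat_cong p 1 (\<Sum>k = 0..n. of_nat ((2 * k) choose k) * catalan k / w ^ k) S"
    by (simp add: S_def catalan_def atLeast0AtMost power2_eq_square field_simps)
  have "of_nat p = (2 * of_nat n + 1 :: rat)" using assms(2) by simp
  \<comment> \<open>The difference is \<open>S + 4 n (n + 1) S = p^2 S\<close>, written with one
    factor \<open>p\<close> split off as the modulus.\<close>
  then have "S - of_int (4 * (1 - x) * poly (pderiv (legendre_poly n)) x) = of_nat p ^ 1 * (of_nat p * S)"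
    using sum_legendre_coeff_div_Suc[of n x, folded S_def] by (simp add: algebra_simps) 
  moreover have "p_integral p S" using 1 by (simp add: rat_cong_def)
  ultimately have "rat_cong p 1 S (of_int (4 * (1 - x) * poly (pderiv (legendre_poly n)) x))"
    using assms(1) by (intro rat_congI[of _ _ "of_nat p * S"] p_integral_mult p_integral_of_int p_integral_of_nat)
  with 1 show ?thesis by (rule rat_cong_trans[OF assms(1)])
qed

lemma sum_central_binomial_shifted_cong_0:
  assumes "prime p" "p = 2 * n + 1" "odd (n + d)"
  shows "rat_cong p 1
    (\<Sum>k = 0..n. of_nat ((2 * k) choose k) * of_nat ((2 * k) choose (k + d)) / 8 ^ k) 0"
proof -
  have pow8: "(8 :: rat) ^ k = 2 ^ (3 * k)" for k by (simp add: power_mult)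
  have "odd p" using assms(2) by simp
  then have pow2: "p_integral p (1 / 2 ^ k)" for k
    using p_integral_inverse_of_int[OF not_dvd_power_two[OF assms(1), of k]] by simp
  have "rat_cong p 1
      (1 / 2 ^ (3 * k) * of_nat ((2 * k) choose (k + d)) * of_int (int ((2 * k) choose k)))
      (1 / 2 ^ (3 * k) * of_nat ((2 * k) choose (k + d)) * of_int ((- 4) ^ k * int (n choose k)))"
    if "k \<in> {0..n}" for k
    using central_binomial_cong[OF assms(1,2), of k] that assms(2)
    by (intro rat_cong_mult_left rat_cong_of_int p_integral_mult pow2 p_integral_of_nat assms(1)) auto
  from rat_cong_sum[OF assms(1) this]
  have "rat_cong p 1
      (\<Sum>k = 0..n. 1 / 2 ^ (3 * k) * of_nat ((2 * k) choose (k + d)) * of_int (int ((2 * k) choose k)))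
      (\<Sum>k = 0..n. 1 / 2 ^ (3 * k) * of_nat ((2 * k) choose (k + d))
        * of_int ((- 4) ^ k * int (n choose k)))" .
  \<comment> \<open>After replacing one central binomial, the powers combine to
    \<open>(-4)^k / 8^k = (-1)^k 2^(n - k) / 2^n\<close>, which exposes the vanishing sum.\<close>
  moreover have "(\<Sum>k = 0..n. 1 / 2 ^ (3 * k) * of_nat ((2 * k) choose (k + d))
        * of_int (int ((2 * k) choose k)) :: rat)
      = (\<Sum>k = 0..n. of_nat ((2 * k) choose k) * of_nat ((2 * k) choose (k + d)) / 8 ^ k)"
    by (simp add: pow8 mult.commute)
  moreover have "(\<Sum>k = 0..n. 1 / 2 ^ (3 * k) * of_nat ((2 * k) choose (k + d))
        * of_int ((- 4) ^ k * int (n choose k)) :: rat)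
      = (\<Sum>k = 0..n. 1 / 2 ^ n * of_int ((- 1) ^ k * int (n choose k) * 2 ^ (n - k)
        * int ((2 * k) choose (k + d))))"
  proof (rule sum.cong)
    fix k assume "k \<in> {0..n}"
    then have "(2 :: rat) ^ n = 2 ^ (n - k) * 2 ^ k" by (simp flip: power_add)
    moreover have "(2 :: rat) ^ (3 * k) = 4 ^ k * 2 ^ k"
      by (simp add: power_mult flip: power_mult_distrib)
    moreover have "(- 4 :: rat) ^ k = (- 1) ^ k * 4 ^ k" by (simp flip: power_mult_distrib)
    ultimately show "1 / 2 ^ (3 * k) * of_nat ((2 * k) choose (k + d))
          * of_int ((- 4) ^ k * int (n choose k))
        = (1 / 2 ^ n * of_int ((- 1) ^ k * int (n choose k) * 2 ^ (n - k)
          * int ((2 * k) choose (k + d))) :: rat)"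
      by simp
  qed simp
  moreover have "\<dots> = 1 / 2 ^ n * of_int (\<Sum>k\<le>n. (- 1) ^ k * int (n choose k) * 2 ^ (n - k)
      * int ((2 * k) choose (k + d)))"
    by (simp only: sum_distrib_left of_int_sum atLeast0AtMost)
  ultimately show ?thesis by (simp only: sum_binomial_shifted_eq_0[OF assms(3)]) simp
qed

section \<open>Assembly of both parts from the values at 2 and -1\<close>

theorem theorem1p3:
  fixes p :: nat
  assumes "prime p" and "odd p"
  shows
    "([p = 3] (mod 4) \<longrightarrow>
        rat_cong p 1
          (\<Sum>k = 0..(p - 1) div 2. of_nat ((2 * k) choose k) * catalan k / 8 ^ k)
          (- 2 * (\<Sum>k = 0..(p - 1) div 2. of_nat k * of_nat ((2 * k) choose k) ^ 2 / 8 ^ k)) \<and>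
        rat_cong p 1
          (- 2 * (\<Sum>k = 0..(p - 1) div 2. of_nat k * of_nat ((2 * k) choose k) ^ 2 / 8 ^ k))
          (- (1 / 2) * (\<Sum>k = 0..(p - 1) div 2. of_nat ((2 * k) choose k) * catalan k / (- 16) ^ k)) \<and>
        rat_cong p 1
          (- (1 / 2) * (\<Sum>k = 0..(p - 1) div 2. of_nat ((2 * k) choose k) * catalan k / (- 16) ^ k))
          (4 * (\<Sum>k = 0..(p - 1) div 2. of_nat k * of_nat ((2 * k) choose k) ^ 2 / (- 16) ^ k)) \<and>
        rat_cong p 1
          (4 * (\<Sum>k = 0..(p - 1) div 2. of_nat k * of_nat ((2 * k) choose k) ^ 2 / (- 16) ^ k))
          ((- 1) ^ ((p + 1) div 4) / 2 * of_nat (((p + 1) div 2) choose ((p + 1) div 4))) \<and>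
        rat_cong p 2
          (\<Sum>k = 0..(p - 1) div 2. of_nat ((2 * k) choose k) ^ 2 / 8 ^ k)
          (- (\<Sum>k = 0..(p - 1) div 2. of_nat ((2 * k) choose k) ^ 2 / (- 16) ^ k)) \<and>
        rat_cong p 2
          (- (\<Sum>k = 0..(p - 1) div 2. of_nat ((2 * k) choose k) ^ 2 / (- 16) ^ k))
          (2 * of_nat p * (- 1) ^ ((p + 1) div 4) /
             of_nat (((p + 1) div 2) choose ((p + 1) div 4)))) \<and>
     (\<forall>d \<in> {0..(p - 1) div 2}. [d = (p + 1) div 2] (mod 2) \<longrightarrow>
        rat_cong p 1
          (\<Sum>k = 0..(p - 1) div 2.
             of_nat ((2 * k) choose k) * of_nat ((2 * k) choose (k + d)) / 8 ^ k)
          0)"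
proof -
  define n where "n = (p - 1) div 2"
  have p: "p = 2 * n + 1" using \<open>odd p\<close> by (auto simp: n_def elim: oddE)
  have half: "(p - 1) div 2 = n" by (simp add: n_def)
  \<comment> \<open>Since \<open>(p + 1) / 2 = n + 1\<close>, the parity condition on
    \<open>d\<close> says exactly that \<open>n + d\<close> is odd.\<close>
  have "odd (n + d)" if "[d = (p + 1) div 2] (mod 2)" for d
    using that p unfolding cong_def by presburger
  then have shifted: "\<forall>d \<in> {0..n}. [d = (p + 1) div 2] (mod 2) \<longrightarrow> rat_cong p 1
      (\<Sum>k = 0..n. of_nat ((2 * k) choose k) * of_nat ((2 * k) choose (k + d)) / 8 ^ k) 0"
    using sum_central_binomial_shifted_cong_0[OF \<open>prime p\<close> p] by blast
  show ?thesis
    unfolding half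
  proof (intro conjI impI shifted)
    assume "[p = 3] (mod 4)"
    then have "p mod 4 = 3" by (simp add: cong_def)
    then obtain j where j: "p = 4 * j + 3" by (metis mult_div_mod_eq)
    then have n: "n = 2 * j + 1" and m: "(p + 1) div 4 = Suc j" "(p + 1) div 2 = 2 * Suc j"
      using p by simp_all
    then have "odd n" by simp
    let ?F = "legendre_poly n" and ?B = "int ((2 * Suc j) choose Suc j)"
    define s where "s = poly ?F (- 1)"
    define E where "E = poly (pderiv ?F) (- 1)"
    \<comment> \<open>As \<open>2 = 1 - (-1)\<close> and \<open>n\<close> is odd, the reflection
      reduces everything to \<open>x = -1\<close>.\<close>
    have F2: "poly ?F 2 = - s" and dF2: "poly (pderiv ?F) 2 = E"
      using poly_legendre_poly_reflect[OF \<open>odd n\<close>, of "-1"]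
        poly_pderiv_legendre_poly_reflect[OF \<open>odd n\<close>, of "-1"] by (simp_all add: s_def E_def)
    note mult = rat_cong_mult_left[OF \<open>prime p\<close>]
    \<comment> \<open>Each member of a chain is compared with one common integer,
      \<open>-4 E\<close> modulo \<open>p\<close> or \<open>-s\<close> modulo \<open>p^2\<close>;
      this rule then links neighbours.\<close>
    note trans = rat_cong_trans[OF \<open>prime p\<close> _ rat_cong_sym[OF \<open>prime p\<close>]]
    have "p_integral p (1 / 2)"
      using p_integral_inverse_of_int[OF not_dvd_power_two[OF assms, of 1]] by simp
    have c1: "rat_cong p 1 (\<Sum>k = 0..n. of_nat ((2 * k) choose k) * catalan k / 8 ^ k) (of_int (- 4 * E))"
      using sum_central_binomial_catalan_cong[OF \<open>prime p\<close> p, of 8 2] by (simp add: dF2)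
    have c2: "rat_cong p 1 (- 2 * (\<Sum>k = 0..n. of_nat k * of_nat ((2 * k) choose k) ^ 2 / 8 ^ k)) (of_int (- 4 * E))"
      using mult[OF p_integral_of_int[OF \<open>prime p\<close>, of "-2"]
          sum_index_central_binomial_sq_cong[OF \<open>prime p\<close> p, of 8 2]] by (simp add: dF2)
    have c3: "rat_cong p 1 (- (1 / 2) * (\<Sum>k = 0..n. of_nat ((2 * k) choose k) * catalan k / (- 16) ^ k)) (of_int (- 4 * E))"
      using mult[OF p_integral_minus[OF \<open>prime p\<close> \<open>p_integral p (1 / 2)\<close>]
          sum_central_binomial_catalan_cong[OF \<open>prime p\<close> p, of "-16" "-1"]] by (simp add: E_def)
    have c4: "rat_cong p 1 (4 * (\<Sum>k = 0..n. of_nat k * of_nat ((2 * k) choose k) ^ 2 / (- 16) ^ k)) (of_int (- 4 * E))"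
      using mult[OF p_integral_of_int[OF \<open>prime p\<close>, of 4]
          sum_index_central_binomial_sq_cong[OF \<open>prime p\<close> p, of "-16" "-1"]] by (simp add: E_def)
    have "[(- 1) ^ Suc j * ?B = - 8 * E] (mod int p ^ 1)"
      using cong_scalar_left[OF legendre_poly_minus_one(2)[OF \<open>prime p\<close> p n, THEN cong_sym], of "-1"]
      by (simp add: E_def del: binomial_Suc_Suc)
    from mult[OF \<open>p_integral p (1 / 2)\<close> rat_cong_of_int[OF \<open>prime p\<close> this]]
    have c5: "rat_cong p 1 ((- 1) ^ ((p + 1) div 4) / 2 * of_nat (((p + 1) div 2) choose ((p + 1) div 4))) (of_int (- 4 * E))"
      unfolding m by (simp del: binomial_Suc_Suc)
    show "rat_cong p 1 (\<Sum>k = 0..n. of_nat ((2 * k) choose k) * catalan k / 8 ^ k)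
        (- 2 * (\<Sum>k = 0..n. of_nat k * of_nat ((2 * k) choose k) ^ 2 / 8 ^ k))"
      by (rule trans[OF c1 c2])
    show "rat_cong p 1 (- 2 * (\<Sum>k = 0..n. of_nat k * of_nat ((2 * k) choose k) ^ 2 / 8 ^ k))
        (- (1 / 2) * (\<Sum>k = 0..n. of_nat ((2 * k) choose k) * catalan k / (- 16) ^ k))"
      by (rule trans[OF c2 c3])
    show "rat_cong p 1 (- (1 / 2) * (\<Sum>k = 0..n. of_nat ((2 * k) choose k) * catalan k / (- 16) ^ k))
        (4 * (\<Sum>k = 0..n. of_nat k * of_nat ((2 * k) choose k) ^ 2 / (- 16) ^ k))"
      by (rule trans[OF c3 c4])
    show "rat_cong p 1 (4 * (\<Sum>k = 0..n. of_nat k * of_nat ((2 * k) choose k) ^ 2 / (- 16) ^ k))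
        ((- 1) ^ ((p + 1) div 4) / 2 * of_nat (((p + 1) div 2) choose ((p + 1) div 4)))"
      by (rule trans[OF c4 c5])
    have e1: "rat_cong p 2 (\<Sum>k = 0..n. of_nat ((2 * k) choose k) ^ 2 / 8 ^ k) (of_int (- s))"
      using sum_central_binomial_sq_cong[OF \<open>prime p\<close> p, of 8 2] by (simp add: F2)
    have e2: "rat_cong p 2 (- (\<Sum>k = 0..n. of_nat ((2 * k) choose k) ^ 2 / (- 16) ^ k)) (of_int (- s))"
      using rat_cong_minus[OF \<open>prime p\<close> sum_central_binomial_sq_cong[OF \<open>prime p\<close> p, of "-16" "-1"]]
      by (simp add: s_def)
    \<comment> \<open>\<open>B\<close> divides \<open>(2j + 2)!\<close>, and
      \<open>2j + 2 < 4j + 3 = p\<close>.\<close>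
    have B: "\<not> int p dvd ?B"
    proof
      assume "int p dvd ?B"
      then have "p dvd fact (2 * Suc j)"
        using binomial_fact_lemma[of "Suc j" "2 * Suc j"]
        by (metis dvd_mult int_dvd_int_iff le_add1 mult_2)
      then show False using \<open>prime p\<close> j by (simp add: prime_dvd_fact_iff del: fact_Suc)
    qed
    \<comment> \<open>Multiplying by \<open>(-1)^j\<close> moves the sign to the other side, leaving
      a bare \<open>B\<close> to divide by.\<close>
    have "[(- 1) ^ j * ((- 1) ^ j * ?B * s) = (- 1) ^ j * (2 * int p)] (mod int p ^ 2)"
      unfolding s_def by (intro cong_scalar_left legendre_poly_minus_one(1)[OF \<open>prime p\<close> p n])
    then have "[?B * s = (- 1) ^ j * (2 * int p)] (mod int p ^ 2)"
      by (simp add: mult.assoc[symmetric] del: binomial_Suc_Suc flip: power_mult_distrib)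
    from cong_scalar_left[OF cong_sym[OF this], of "-1"]
    have "[2 * int p * (- 1) ^ Suc j = ?B * (- s)] (mod int p ^ 2)"
      by (simp add: mult_ac del: binomial_Suc_Suc)
    from rat_cong_divide[OF \<open>prime p\<close> B this]
    have e3: "rat_cong p 2 (2 * of_nat p * (- 1) ^ ((p + 1) div 4)
        / of_nat (((p + 1) div 2) choose ((p + 1) div 4))) (of_int (- s))"
      unfolding m by (simp del: binomial_Suc_Suc)
    show "rat_cong p 2 (\<Sum>k = 0..n. of_nat ((2 * k) choose k) ^ 2 / 8 ^ k)
        (- (\<Sum>k = 0..n. of_nat ((2 * k) choose k) ^ 2 / (- 16) ^ k))"
      by (rule trans[OF e1 e2])
    show "rat_cong p 2 (- (\<Sum>k = 0..n. of_nat ((2 * k) choose k) ^ 2 / (- 16) ^ k))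
        (2 * of_nat p * (- 1) ^ ((p + 1) div 4) / of_nat (((p + 1) div 2) choose ((p + 1) div 4)))"
      by (rule trans[OF e2 e3])
  qed
qed

end
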